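(* There exist absolute constants $\varepsilon_0>0$ and $C>0$ such that for all $0<\varepsilon\le\varepsilon_0$, every integer $T\ge 1$, and every $\varepsilon$-differentially private online learning algorithm for the class $\mathrm{POINT}_{\mathbb{N}}$ over $T$ rounds, there is an adaptive adversary in the realizable setting against which the expected number of mistakes $\mathbb{E}\left[\sum_{t=1}^T\mathbb{I}[h_t(x_t)\ne y_t]\right]$ of the algorithm is at least $C\,T$.
   Context: $\mathrm{POINT}_{\mathbb{N}}$ is the class of point functions over $\mathbb{N}$: $\mathrm{POINT}_{\mathbb{N}}=\{f_x:x\in\mathbb{N}\}$ where $f_x:\mathbb{N}\to\{0,1\}$ maps $x$ to $1$ and all other elements to $0$. Online learning over domain $\mathcal{X}$ (here $\mathcal{X}=\mathbb{N}$): over $T$ rounds, in round $t$ a (randomized) learner outputs a hypothesis $h_t\in\{0,1\}^{\mathcal{X}}$ (not necessarily in the class), depending only on $(x_1,y_1),\dots,(x_{t-1},y_{t-1})$ and its own randomness, while the adversary presents a pair $(x_t,y_t)\in\mathcal{X}\times\{0,1\}$. An adaptive adversary may choose (possibly at random) $(x_t,y_t)$ based on $h_1,\dots,h_{t-1}$ and $(x_1,y_1),\dots,(x_{t-1},y_{t-1})$. Realizable setting: it is guaranteed that some $h^\star$ in the class satisfies $y_t=h^\star(x_t)$ for all $t\in[T]$. Privacy: with adaptive adversaries, $\varepsilon$-differential privacy of an online algorithm $\mathcal{A}$ means adaptive differential privacy: consider any (privacy) adversary $\mathsf{Adv}$ who adaptively generates two sequences $S_1,S_2$ differing in only one entry;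 for a bit $b\in\{1,2\}$ unknown to $\mathcal{A}$ and $\mathsf{Adv}$, at each time-step $t$ the adversary generates $S_1[t],S_2[t]$ based on the past history and $\mathcal{A}$ receives $S_b[t]$. Let $\mathcal{A}\circ\mathsf{Adv}(b)$ be the view of $\mathsf{Adv}$ (the entire output of $\mathcal{A}$ and the internal randomness of $\mathsf{Adv}$). Then for every such $\mathsf{Adv}$ and every event $O$, $\Pr[\mathcal{A}\circ\mathsf{Adv}(1)\in O]\le e^{\varepsilon}\Pr[\mathcal{A}\circ\mathsf{Adv}(2)\in O]$. (For pure privacy, $\delta=0$, this is known to be equivalent to ordinary $\varepsilon$-differential privacy: $\Pr[\mathcal{A}(S_1)\in O]\le e^{\varepsilon}\Pr[\mathcal{A}(S_2)\in O]$ for all fixed sequences $S_1,S_2$ differing in one entry and all events $O$, where $\mathcal{A}(S)$ is the entire output sequence.) *)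

theory Defs
  imports "HOL-Probability.Probability"
begin

type_synonym hypothesis = "nat \<Rightarrow> bool"
type_synonym labelled = "nat \<times> bool"

definition point_fun :: "nat \<Rightarrow> hypothesis" where
  "point_fun x = (\<lambda>z. z = x)"

definition POINT :: "hypothesis set" where
  "POINT = range point_fun"

definition hyp_space :: "hypothesis measure" where
  "hyp_space = PiM UNIV (\<lambda>_. count_space UNIV)"

text \<open>
  A deterministic learner maps the examples of the rounds before \<open>t\<close> to the hypothesis of round \<open>t\<close>.
  A randomized learner is a probability measure on deterministic ones: if the internal
  randomness is \<open>\<omega>\<close>, take the law of the random function that sends the examples seen so far
  to the hypothesis output under \<open>\<omega>\<close>. This makes no assumption on the space of \<open>\<omega>\<close>.
\<close>

type_synonym det_learner = "labelled list \<Rightarrow> hypothesis"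

definition online_learner :: "det_learner measure \<Rightarrow> bool" where
  "online_learner P \<longleftrightarrow> prob_space P \<and> sets P = sets (PiM UNIV (\<lambda>_. hyp_space))"

text \<open>
  An adversary with internal randomness \<open>r\<close> chooses its move of type \<open>'a\<close> from the previous rounds,
  each recorded as the hypothesis output by the learner and the move made by the adversary.
  The move is a labelled example in the learning game, and a pair \<open>(S\<^sub>1[t], S\<^sub>2[t])\<close> in the privacy
  game; \<open>f\<close> is the part of the move passed on to the learner (\<^const>\<open>id\<close> in the former game,
  \<^const>\<open>fst\<close> or \<^const>\<open>snd\<close> in the latter, according to the hidden bit).
\<close>

type_synonym 'a strategy = "real \<Rightarrow> (hypothesis \<times> 'a) list \<Rightarrow> 'a"

primrec play ::
  "('a \<Rightarrow> labelled) \<Rightarrow> det_learner \<Rightarrow> ((hypothesis \<times> 'a) list \<Rightarrow> 'a) \<Rightarrow> nat \<Rightarrow> (hypothesis \<times> 'a) list"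
where
  "play f L A 0 = []"
| "play f L A (Suc n) =
     (let H = play f L A n in H @ [(L (map (f \<circ> snd) H), A H)])"

text \<open>
  The law \<open>N\<close> of the internal randomness is an arbitrary probability space on the reals. The move
  is jointly measurable in the randomness and the past hypotheses, for each list \<open>ms\<close> of
  past moves; as there are only countably many such lists in both games, nothing more is needed.
\<close>

definition adversary :: "real measure \<Rightarrow> 'a strategy \<Rightarrow> bool" where
  "adversary N A \<longleftrightarrow> prob_space N \<and>
     (\<forall>ms. (\<lambda>(r, hs). A r (zip (map hs [0..<length ms]) ms))
        \<in> N \<Otimes>\<^sub>M PiM {..<length ms} (\<lambda>_. hyp_space) \<rightarrow>\<^sub>M count_space UNIV)"

text \<open>Histories of \<open>T\<close> rounds that can arise when the hypotheses are arbitrary.\<close>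

definition possible_history :: "nat \<Rightarrow> real measure \<Rightarrow> 'a strategy \<Rightarrow> (hypothesis \<times> 'a) list \<Rightarrow> bool" where
  "possible_history T N A H \<longleftrightarrow> length H = T \<and>
     (\<exists>r\<in>space N. \<forall>t<T. snd (H ! t) = A r (take t H))"

definition realizable_adversary ::
  "hypothesis set \<Rightarrow> nat \<Rightarrow> real measure \<Rightarrow> labelled strategy \<Rightarrow> bool" where
  "realizable_adversary F T N A \<longleftrightarrow> adversary N A \<and>
     (\<forall>H. possible_history T N A H \<longrightarrow> (\<exists>h\<in>F. \<forall>(_, x, y) \<in> set H. y = h x))"

definition expected_mistakes ::
  "nat \<Rightarrow> det_learner measure \<Rightarrow> real measure \<Rightarrow> labelled strategy \<Rightarrow> real" where
  "expected_mistakes T P N A =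
     (\<integral>(L, r). (\<Sum>(h, x, y) \<leftarrow> play id L (A r) T. of_bool (h x \<noteq> y)) \<partial>(P \<Otimes>\<^sub>M N))"

definition privacy_adversary :: "nat \<Rightarrow> real measure \<Rightarrow> (labelled \<times> labelled) strategy \<Rightarrow> bool" where
  "privacy_adversary T N A \<longleftrightarrow> adversary N A \<and>
     (\<forall>H. possible_history T N A H \<longrightarrow>
        card {t. t < T \<and> fst (snd (H ! t)) \<noteq> snd (snd (H ! t))} \<le> 1)"

text \<open>The law of all outputs of the learner together with the adversary's internal randomness.\<close>

definition view ::
  "(labelled \<times> labelled \<Rightarrow> labelled) \<Rightarrow> nat \<Rightarrow> det_learner measure \<Rightarrow> real measure \<Rightarrow>
   (labelled \<times> labelled) strategy \<Rightarrow> ((nat \<Rightarrow> hypothesis) \<times> real) measure" where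
  "view f T P N A =
     distr (P \<Otimes>\<^sub>M N) (PiM {..<T} (\<lambda>_. hyp_space) \<Otimes>\<^sub>M N)
       (\<lambda>(L, r). (\<lambda>t\<in>{..<T}. fst (play f L (A r) T ! t), r))"

definition differentially_private :: "real \<Rightarrow> nat \<Rightarrow> det_learner measure \<Rightarrow> bool" where
  "differentially_private \<epsilon> T P \<longleftrightarrow>
     (\<forall>N A. privacy_adversary T N A \<longrightarrow>
        (\<forall>E \<in> sets (PiM {..<T} (\<lambda>_. hyp_space) \<Otimes>\<^sub>M N).
           measure (view fst T P N A) E \<le> exp \<epsilon> * measure (view snd T P N A) E))"

end

theory Submission
  imports Defs
begin

text \<open>
  Draw a target \<open>x\<close> uniformly from \<open>{..<M}\<close>, where \<open>M\<close> is exponential in \<open>\<epsilon> T\<close>. Knowing the law of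
  the learner, the adversary looks at its past outputs and asks whether some point \<open>z\<close> will be
  labelled \<open>True\<close> with probability at least 1/4. If so it presents \<open>z\<close>, which differs from the
  target with high probability, and the learner errs with constant probability. Otherwise it
  presents \<open>(x, True)\<close>. To be correct the learner must then label \<open>x\<close> with \<open>True\<close>, although every
  fixed point is labelled \<open>True\<close> with probability below 1/4; so a correct prediction carries a
  constant amount of information about \<open>x\<close>. By group privacy, the outputs of all rounds together
  carry at most \<open>\<epsilon> T\<close> of it, so that for small \<open>\<epsilon>\<close> a constant fraction of the rounds are mistakes.

  The adversary is deterministic and sees only the restrictions of the hypotheses to \<open>{..<M}\<close>.
  Its interaction with the learner therefore has finitely many transcripts, and for a single
  transcript the adaptive privacy guarantee follows from the one for fixed input sequences.
\<close>

section \<open>Outputs on fixed inputs\<close>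

definition truncate :: "nat \<Rightarrow> hypothesis \<Rightarrow> bool list" where
  "truncate M h = map h [0..<M]"

lemma length_truncate [simp]: "length (truncate M h) = M"
  by (simp add: truncate_def)

lemma nth_truncate [simp]: "z < M \<Longrightarrow> truncate M h ! z = h z"
  by (simp add: truncate_def)

definition outputs :: "nat \<Rightarrow> labelled list \<Rightarrow> nat \<Rightarrow> det_learner \<Rightarrow> bool list list" where
  "outputs M xs n L = map (\<lambda>t. truncate M (L (take t xs))) [0..<n]"

lemma outputs_0 [simp]: "outputs M xs 0 L = []"
  by (simp add: outputs_def)

lemma outputs_Suc [simp]: "outputs M xs (Suc n) L = outputs M xs n L @ [truncate M (L (take n xs))]"
  by (simp add: outputs_def)

lemma length_outputs [simp]: "length (outputs M xs n L) = n"
  by (simp add: outputs_def)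

lemma outputs_append: "n \<le> length xs \<Longrightarrow> outputs M (xs @ ys) n L = outputs M xs n L"
  by (simp add: outputs_def)

text \<open>Lists over a countable type are countable, so each value of the prefix can be treated
  separately.\<close>

lemma measurable_map_upt:
  fixes f :: "nat \<Rightarrow> 'a \<Rightarrow> 'b :: countable"
  assumes "\<And>i. i < n \<Longrightarrow> f i \<in> N \<rightarrow>\<^sub>M count_space UNIV"
  shows "(\<lambda>w. map (\<lambda>i. f i w) [0..<n]) \<in> N \<rightarrow>\<^sub>M count_space UNIV"
  using assms
proof (induction n)
  case (Suc n)
  then have [measurable]: "(\<lambda>w. map (\<lambda>i. f i w) [0..<n]) \<in> N \<rightarrow>\<^sub>M count_space UNIV"
    and "f n \<in> N \<rightarrow>\<^sub>M count_space UNIV" by simp_all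
  then have "(\<lambda>w. l @ [f n w]) \<in> N \<rightarrow>\<^sub>M count_space UNIV" for l
    by (intro measurable_compose[OF _ measurable_count_space])
  then show ?case
    by (simp add: measurable_compose_countable[where f = "\<lambda>l w. l @ [f n w]"])
qed simp

lemma measurable_truncate: "truncate M \<in> hyp_space \<rightarrow>\<^sub>M count_space UNIV"
  unfolding truncate_def[abs_def] hyp_space_def
  by (rule measurable_map_upt) (rule measurable_component_singleton, simp)

definition output_prob :: "det_learner measure \<Rightarrow> nat \<Rightarrow> labelled list \<Rightarrow> bool list list \<Rightarrow> real" where
  "output_prob P M xs gs = measure P {L. outputs M xs (length gs) L = gs}"

lemma space_hyp_space: "space hyp_space = UNIV"
  by (simp add: hyp_space_def space_PiM)

lemma space_online_learner: "online_learner P \<Longrightarrow> space P = UNIV"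
  using sets_eq_imp_space_eq[of P] by (auto simp: online_learner_def space_PiM space_hyp_space)

lemma measurable_learner_apply:
  assumes "online_learner P"
  shows "(\<lambda>L. L ms) \<in> P \<rightarrow>\<^sub>M hyp_space"
proof -
  have "sets P = sets (PiM UNIV (\<lambda>_. hyp_space))" using assms by (simp add: online_learner_def)
  then show ?thesis by (simp add: measurable_cong_sets[of P _ hyp_space hyp_space])
qed

lemma outputs_event:
  assumes "online_learner P"
  shows "{L. outputs M xs n L = gs} \<in> sets P"
proof -
  have "outputs M xs n \<in> P \<rightarrow>\<^sub>M count_space UNIV"
    unfolding outputs_def[abs_def]
    by (rule measurable_map_upt)
       (rule measurable_compose[OF measurable_learner_apply[OF assms] measurable_truncate])
  from measurable_sets[OF this, of "{gs}"] show ?thesis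
    by (simp add: space_online_learner[OF assms] vimage_def)
qed

lemma finite_hypotheses: "finite {g :: bool list. length g = M}"
  using finite_lists_length_eq[of "UNIV :: bool set" M] by simp

text \<open>The possible last outputs \<open>g\<close> partition the event that the earlier outputs
  are \<open>gs\<close>.\<close>

lemma sum_output_prob:
  assumes "online_learner P"
  shows "(\<Sum>g | length g = M. output_prob P M xs (gs @ [g])) = output_prob P M xs gs"
proof -
  interpret prob_space P using assms by (simp add: online_learner_def)
  let ?E = "\<lambda>g. {L. outputs M xs (Suc (length gs)) L = gs @ [g]}"
  have "prob (\<Union>g\<in>{g. length g = M}. ?E g) = (\<Sum>g | length g = M. prob (?E g))"
    by (rule finite_measure_finite_Union[OF finite_hypotheses])
       (auto simp: outputs_event[OF assms] disjoint_family_on_def simp del: outputs_Suc)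
  moreover have "(\<Union>g\<in>{g. length g = M}. ?E g) = {L. outputs M xs (length gs) L = gs}"
    by auto
  ultimately show ?thesis by (simp add: output_prob_def)
qed

section \<open>Privacy for fixed input sequences\<close>

lemma play_oblivious:
  assumes "\<And>H. A H = m (length H)"
  shows "play f L A n = map (\<lambda>t. (L (map (f \<circ> m) [0..<t]), m t)) [0..<n]"
  by (induction n) (simp_all add: assms Let_def comp_def)

text \<open>An oblivious adversary presenting \<open>xs\<close> and \<open>ys\<close> side by side
  turns adaptive privacy into privacy for fixed inputs.\<close>

lemma output_prob_private_step:
  assumes P: "online_learner P" "differentially_private \<epsilon> T P"
    and len: "length xs = length gs" "length ys = length gs" "length gs \<le> T"
    and neighbours: "\<And>t. t < length gs \<Longrightarrow> t \<noteq> i \<Longrightarrow> xs ! t = ys ! t"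
  shows "output_prob P M xs gs \<le> exp \<epsilon> * output_prob P M ys gs"
proof -
  define N where "N = return borel (0 :: real)"
  interpret N: prob_space N unfolding N_def by (rule prob_space_return) simp
  \<comment> \<open>After \<open>length gs\<close> rounds both sequences continue with the same
    dummy example, filling up the \<open>T\<close> rounds without a further difference.\<close>
  define m where "m t = (if t < length gs then (xs ! t, ys ! t) else ((0, False), (0, False)))" for t
  define A :: "(labelled \<times> labelled) strategy" where "A r H = m (length H)" for r H
  define E where "E = {w \<in> space (PiM {..<T} (\<lambda>_. hyp_space) \<Otimes>\<^sub>M N).
    map (\<lambda>t. truncate M (fst w t)) [0..<length gs] = gs}"
  have "(\<lambda>w. map (\<lambda>t. truncate M (fst w t)) [0..<length gs])
      \<in> PiM {..<T} (\<lambda>_. hyp_space) \<Otimes>\<^sub>M N \<rightarrow>\<^sub>M count_space UNIV"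
    using len(3) by (intro measurable_map_upt measurable_compose[OF _ measurable_truncate]) measurable
  then have E: "E \<in> sets (PiM {..<T} (\<lambda>_. hyp_space) \<Otimes>\<^sub>M N)"
    unfolding E_def by measurable
  have view_E: "measure (view f T P N A) E = output_prob P M zs gs"
    if zs: "length zs = length gs" "\<And>t. t < length gs \<Longrightarrow> f (xs ! t, ys ! t) = zs ! t" for f zs
  proof -
    have F: "(\<lambda>(L, r). (\<lambda>t\<in>{..<T}. fst (play f L (A r) T ! t), r)) =
      (\<lambda>(L, r). (\<lambda>t\<in>{..<T}. L (map (f \<circ> m) [0..<t]), r))"
      using play_oblivious[of "A _" m f _ T] by (auto simp: A_def fun_eq_iff restrict_def)
    have inputs: "map (f \<circ> m) [0..<t] = take t zs" if "t \<le> length gs" for t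
      using that zs by (intro nth_equalityI) (auto simp: m_def)
    have meas: "(\<lambda>(L, r). (\<lambda>t\<in>{..<T}. L (map (f \<circ> m) [0..<t]), r))
        \<in> P \<Otimes>\<^sub>M N \<rightarrow>\<^sub>M PiM {..<T} (\<lambda>_. hyp_space) \<Otimes>\<^sub>M N"
      unfolding split_beta
      by (intro measurable_Pair measurable_restrict
          measurable_compose[OF measurable_fst measurable_learner_apply[OF P(1)]] measurable_snd)
    have "measure (view f T P N A) E =
      measure (P \<Otimes>\<^sub>M N) ((\<lambda>(L, r). (\<lambda>t\<in>{..<T}. L (map (f \<circ> m) [0..<t]), r)) -` E \<inter> space (P \<Otimes>\<^sub>M N))"
      unfolding view_def F by (rule measure_distr[OF meas E])
    also have "(\<lambda>(L, r). (\<lambda>t\<in>{..<T}. L (map (f \<circ> m) [0..<t]), r)) -` E \<inter> space (P \<Otimes>\<^sub>M N) =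
      fst -` {L. outputs M zs (length gs) L = gs} \<inter> space (P \<Otimes>\<^sub>M N)"
    proof -
      have "map (\<lambda>t. truncate M ((\<lambda>t\<in>{..<T}. L (map (f \<circ> m) [0..<t])) t)) [0..<length gs] =
          outputs M zs (length gs) L" for L
        using len(3) inputs by (simp add: outputs_def)
      then show ?thesis
        using measurable_space[OF meas] by (auto simp: E_def)
    qed
    also have "measure (P \<Otimes>\<^sub>M N) \<dots> = measure (distr (P \<Otimes>\<^sub>M N) P fst) {L. outputs M zs (length gs) L = gs}"
      by (rule measure_distr[symmetric]) (auto simp: outputs_event[OF P(1)])
    finally show ?thesis by (simp add: N.distr_pair_fst output_prob_def)
  qed
  have "privacy_adversary T N A"
    unfolding privacy_adversary_def adversary_def
  proof (intro conjI allI impI N.prob_space_axioms)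
    fix H assume "possible_history T N A H"
    then have "snd (H ! t) = m t" if "t < T" for t
      using that by (auto simp: possible_history_def A_def)
    then have "{t. t < T \<and> fst (snd (H ! t)) \<noteq> snd (snd (H ! t))} \<subseteq> {i}"
      by (auto simp: m_def split: if_splits) (use neighbours in blast)
    then show "card {t. t < T \<and> fst (snd (H ! t)) \<noteq> snd (snd (H ! t))} \<le> 1"
      using card_mono[of "{i}"] by fastforce
  qed (simp add: A_def split_beta)
  then have "measure (view fst T P N A) E \<le> exp \<epsilon> * measure (view snd T P N A) E"
    using P(2) E by (simp add: differentially_private_def)
  then show ?thesis using len by (simp add: view_E)
qed

text \<open>Hybrid argument: the entries of \<open>xs\<close> are replaced by those of
  \<open>ys\<close> one at a time, each at the cost of a factor
  \<open>exp \<epsilon>\<close>.\<close>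

lemma output_prob_private:
  assumes P: "online_learner P" "differentially_private \<epsilon> T P"
    and len: "length xs = length gs" "length ys = length gs" "length gs \<le> T" and "\<epsilon> \<ge> 0"
  shows "output_prob P M xs gs \<le> exp (real T * \<epsilon>) * output_prob P M ys gs"
proof -
  let ?hybrid = "\<lambda>k. take k ys @ drop k xs"
  have "output_prob P M xs gs \<le> exp (real k * \<epsilon>) * output_prob P M (?hybrid k) gs"
    if "k \<le> length gs" for k
    using that
  proof (induction k)
    case (Suc k)
    have "output_prob P M (?hybrid k) gs \<le> exp \<epsilon> * output_prob P M (?hybrid (Suc k)) gs"
      by (rule output_prob_private_step[OF P, where i = k])
         (use len Suc.prems in \<open>auto simp: nth_append\<close>)
    then have "exp (real k * \<epsilon>) * output_prob P M (?hybrid k) gs \<le>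
        exp (real k * \<epsilon>) * (exp \<epsilon> * output_prob P M (?hybrid (Suc k)) gs)"
      by (intro mult_left_mono) auto
    also have "\<dots> = exp (real (Suc k) * \<epsilon>) * output_prob P M (?hybrid (Suc k)) gs"
      by (simp add: exp_add algebra_simps)
    finally show ?case using Suc by simp
  qed simp
  from this[of "length gs"] have "output_prob P M xs gs \<le> exp (real (length gs) * \<epsilon>) * output_prob P M ys gs"
    using len by simp
  also have "\<dots> \<le> exp (real T * \<epsilon>) * output_prob P M ys gs"
    using len \<open>\<epsilon> \<ge> 0\<close> by (intro mult_right_mono) (auto simp: output_prob_def mult_right_mono)
  finally show ?thesis .
qed

section \<open>Mistakes against information\<close>

text \<open>Separates the decisions, which will depend on the outputs only, from the target
  \<open>x\<close>, for which \<open>None\<close> stands.\<close>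

definition moves :: "nat \<Rightarrow> nat option list \<Rightarrow> labelled list" where
  "moves x = map (\<lambda>d. case d of None \<Rightarrow> (x, True) | Some z \<Rightarrow> (z, z = x))"

section \<open>Finite transcripts and sums along them\<close>

definition transcripts :: "nat \<Rightarrow> nat \<Rightarrow> bool list list set" where
  "transcripts M n = {gs. set gs \<subseteq> {g. length g = M} \<and> length gs = n}"

lemma finite_transcripts: "finite (transcripts M n)"
  unfolding transcripts_def by (rule finite_lists_length_eq[OF finite_hypotheses])

lemma transcripts_0: "transcripts M 0 = {[]}"
  by (auto simp: transcripts_def)

lemma sum_transcripts_Suc:
  "(\<Sum>gs\<in>transcripts M (Suc n). f gs) =
   (\<Sum>gs\<in>transcripts M n. \<Sum>g | length g = M. f (gs @ [g]))"
proof -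
  have "(\<Sum>gs\<in>transcripts M n. \<Sum>g | length g = M. f (gs @ [g])) =
     (\<Sum>(gs, g)\<in>transcripts M n \<times> {g. length g = M}. f (gs @ [g]))"
    by (simp add: sum.cartesian_product)
  also have "\<dots> = (\<Sum>gs\<in>transcripts M (Suc n). f gs)"
  proof (rule sum.reindex_bij_witness[where i = "\<lambda>gs. (butlast gs, last gs)" and j = "\<lambda>(gs, g). gs @ [g]"])
    fix gs assume "gs \<in> transcripts M (Suc n)"
    then have *: "length gs = Suc n" "set gs \<subseteq> {g. length g = M}" "gs \<noteq> []"
      by (auto simp: transcripts_def)
    then show "(\<lambda>(gs, g). gs @ [g]) (butlast gs, last gs) = gs"
      by simp
    show "(butlast gs, last gs) \<in> transcripts M n \<times> {g. length g = M}"
      using * subsetD[OF *(2) last_in_set[OF *(3)]]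
      by (auto simp: transcripts_def dest: in_set_butlastD)
  qed (auto simp: transcripts_def)
  finally show ?thesis ..
qed

definition tally :: "(bool list list \<Rightarrow> bool list \<Rightarrow> real) \<Rightarrow> bool list list \<Rightarrow> real" where
  "tally c gs = (\<Sum>t<length gs. c (take t gs) (gs ! t))"

lemma tally_Nil [simp]: "tally c [] = 0"
  by (simp add: tally_def)

lemma tally_snoc [simp]: "tally c (gs @ [g]) = tally c gs + c gs g"
  by (simp add: tally_def nth_append)

lemma tally_add: "tally (\<lambda>gs g. c gs g + d gs g) gs = tally c gs + tally d gs"
  by (simp add: tally_def sum.distrib)

lemma tally_cmult: "tally (\<lambda>gs g. r * c gs g) gs = r * tally c gs"
  by (simp add: tally_def sum_distrib_left)

text \<open>
  \<open>q xs gs\<close> stands for the probability that a learner fed with \<open>xs\<close> outputs hypotheses whose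
  restrictions to \<open>{..<M}\<close> are \<open>gs\<close>. The last example of \<open>xs\<close> comes too late to matter.
\<close>

locale transcript_law =
  fixes q :: "labelled list \<Rightarrow> bool list list \<Rightarrow> real" and M T :: nat and a :: real
  assumes q_nonneg: "q xs gs \<ge> 0"
    and q_Nil: "q xs [] = 1"
    and q_sum: "(\<Sum>g | length g = M. q xs (gs @ [g])) = q xs gs"
    and q_snoc: "length xs = length gs \<Longrightarrow> q (xs @ [m]) (gs @ [g]) = q xs (gs @ [g])"
    and q_private: "length xs = length gs \<Longrightarrow> length ys = length gs \<Longrightarrow> length gs \<le> T \<Longrightarrow>
      q xs gs \<le> exp a * q ys gs"
    and M_large: "8 * exp a \<le> real M"
begin

lemma M_pos: "M > 0"
proof -
  have "0 < 8 * exp a" by simp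
  with M_large have "0 < real M" by linarith
  then show ?thesis by simp
qed

text \<open>
  The adversary knows its target \<open>x\<close>, but decides which point to present by looking at the
  outputs only: \<open>Some z\<close> if \<open>z\<close> is likely to be labelled \<open>True\<close> next, when the target is drawn
  uniformly from \<open>{..<M}\<close>, and \<open>None\<close>, meaning the target itself, if there is no such \<open>z\<close>.
\<close>

definition probe :: "nat option list \<Rightarrow> bool list list \<Rightarrow> nat option" where
  "probe ds gs =
    (let likely = (\<lambda>z. z < M \<and>
       (\<Sum>x<M. q (moves x ds) gs) / 4 \<le>
       (\<Sum>x<M. \<Sum>g | length g = M. q (moves x ds) (gs @ [g]) * of_bool (g ! z)))
     in if \<exists>z. likely z then Some (SOME z. likely z) else None)"

text \<open>Listing the outputs latest first makes the recursion primitive: each step appends the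
  decision made from all earlier outputs.\<close>

primrec decisions_rev :: "bool list list \<Rightarrow> nat option list" where
  "decisions_rev [] = []"
| "decisions_rev (g # gs) = decisions_rev gs @ [probe (decisions_rev gs) (rev gs)]"

definition decisions :: "bool list list \<Rightarrow> nat option list" where
  "decisions gs = decisions_rev (rev gs)"

definition decision :: "bool list list \<Rightarrow> nat option" where
  "decision gs = probe (decisions gs) gs"

lemma decisions_Nil [simp]: "decisions [] = []"
  by (simp add: decisions_def)

lemma decisions_snoc [simp]: "decisions (gs @ [g]) = decisions gs @ [decision gs]"
  by (simp add: decisions_def decision_def)

lemma length_decisions [simp]: "length (decisions gs) = length gs"
  by (induction gs rule: rev_induct) auto

definition move :: "nat \<Rightarrow> bool list list \<Rightarrow> labelled" where
  "move x gs = (case decision gs of None \<Rightarrow> (x, True) | Some z \<Rightarrow> (z, z = x))"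

text \<open>\<open>weight x gs / real M\<close> is the joint probability of target \<open>x\<close>
  and outputs \<open>gs\<close> when the target is uniform.\<close>

definition weight :: "nat \<Rightarrow> bool list list \<Rightarrow> real" where
  "weight x gs = q (moves x (decisions gs)) gs"

definition mistake :: "nat \<Rightarrow> bool list list \<Rightarrow> bool list \<Rightarrow> real" where
  "mistake x gs g = of_bool (g ! fst (move x gs) \<noteq> snd (move x gs))"

text \<open>
  The constants make the expectation of \<open>exp (gain z gs g)\<close> at most 1 whenever \<open>g ! z\<close> has
  probability at most 1/4, since \<open>exp (2 / 3) \<le> 2\<close> and \<open>5 / 4 \<le> exp (1 / 4)\<close>.
\<close>

definition gain :: "nat \<Rightarrow> bool list list \<Rightarrow> bool list \<Rightarrow> real" where
  "gain z gs g = (if decision gs = None then 2 / 3 * of_bool (g ! z) - 1 / 4 else 0)"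

lemma length_moves [simp]: "length (moves x ds) = length ds"
  by (simp add: moves_def)

lemma moves_decisions_snoc:
  "moves x (decisions (gs @ [g])) = moves x (decisions gs) @ [move x gs]"
  by (simp add: moves_def move_def)

lemma weight_snoc: "weight x (gs @ [g]) = q (moves x (decisions gs)) (gs @ [g])"
  unfolding weight_def moves_decisions_snoc by (rule q_snoc) simp

lemma weight_nonneg: "weight x gs \<ge> 0"
  by (simp add: weight_def q_nonneg)

lemma weight_Nil [simp]: "weight x [] = 1"
  by (simp add: weight_def q_Nil)

lemma sum_weight_snoc: "(\<Sum>g | length g = M. weight x (gs @ [g])) = weight x gs"
  by (simp add: weight_snoc q_sum) (simp add: weight_def)

lemma sum_weight: "(\<Sum>gs\<in>transcripts M n. weight x gs) = 1"
  by (induction n) (simp_all add: transcripts_0 sum_transcripts_Suc sum_weight_snoc)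

text \<open>The decisions depend on \<open>gs\<close> alone, so any two targets give input lists of
  equal length, which group privacy compares.\<close>

lemma weight_private:
  assumes "length gs \<le> T"
  shows "real M * weight x gs \<le> exp a * (\<Sum>z<M. weight z gs)"
proof -
  have "(\<Sum>z<M. weight x gs) \<le> (\<Sum>z<M. exp a * weight z gs)"
    unfolding weight_def by (intro sum_mono q_private) (use assms in auto)
  then show ?thesis by (simp add: sum_distrib_left)
qed

lemma decision_Some:
  assumes "decision gs = Some z"
  shows "z < M" and "(\<Sum>x<M. weight x gs) / 4 \<le>
    (\<Sum>x<M. \<Sum>g | length g = M. weight x (gs @ [g]) * of_bool (g ! z))"
proof -
  define likely where "likely = (\<lambda>z. z < M \<and> (\<Sum>x<M. weight x gs) / 4 \<le>
    (\<Sum>x<M. \<Sum>g | length g = M. weight x (gs @ [g]) * of_bool (g ! z)))"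
  have "decision gs = (if \<exists>z. likely z then Some (SOME z. likely z) else None)"
    by (simp add: decision_def probe_def likely_def weight_snoc Let_def) (simp add: weight_def)
  then have "likely z" using assms by (metis option.distinct(1) option.inject someI_ex)
  then show "z < M" and "(\<Sum>x<M. weight x gs) / 4 \<le>
    (\<Sum>x<M. \<Sum>g | length g = M. weight x (gs @ [g]) * of_bool (g ! z))"
    by (simp_all add: likely_def)
qed

lemma decision_None:
  assumes "decision gs = None" and "z < M"
  shows "(\<Sum>x<M. \<Sum>g | length g = M. weight x (gs @ [g]) * of_bool (g ! z)) \<le>
    (\<Sum>x<M. weight x gs) / 4"
  using assms unfolding decision_def probe_def weight_snoc
  by (auto simp: Let_def weight_def not_le split: if_splits dest: spec[of _ z])

lemma move_less: "x < M \<Longrightarrow> fst (move x gs) < M"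
  using decision_Some(1) by (auto simp: move_def split: option.splits)

lemma move_correct: "snd (move x gs) = point_fun x (fst (move x gs))"
  by (auto simp: move_def point_fun_def split: option.splits)

text \<open>For each target the weights of the transcripts of a given length sum to 1, so every
  round contributes at least \<open>\<delta> * real M\<close>.\<close>

lemma sum_tally_ge:
  assumes "\<And>gs. length gs < n \<Longrightarrow> \<delta> * (\<Sum>x<M. weight x gs) \<le>
    (\<Sum>x<M. \<Sum>g | length g = M. weight x (gs @ [g]) * c x gs g)"
  shows "\<delta> * real M * real n \<le> (\<Sum>x<M. \<Sum>gs\<in>transcripts M n. weight x gs * tally (c x) gs)"
  using assms
proof (induction n)
  case 0
  then show ?case by (simp add: transcripts_0)
next
  case (Suc n)
  have "\<delta> * real M = \<delta> * (\<Sum>x<M. \<Sum>gs\<in>transcripts M n. weight x gs)"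
    by (simp add: sum_weight)
  also have "\<dots> = (\<Sum>gs\<in>transcripts M n. \<delta> * (\<Sum>x<M. weight x gs))"
    by (subst sum.swap) (simp add: sum_distrib_left)
  also have "\<dots> \<le> (\<Sum>gs\<in>transcripts M n. \<Sum>x<M. \<Sum>g | length g = M. weight x (gs @ [g]) * c x gs g)"
    by (intro sum_mono Suc.prems) (simp add: transcripts_def)
  finally have *: "\<delta> * real M \<le> (\<Sum>x<M. \<Sum>gs\<in>transcripts M n. \<Sum>g | length g = M. weight x (gs @ [g]) * c x gs g)"
    by (subst sum.swap)
  have "\<delta> * real M * real n \<le> (\<Sum>x<M. \<Sum>gs\<in>transcripts M n. weight x gs * tally (c x) gs)"
    using Suc by simp
  also have "\<dots> = (\<Sum>x<M. \<Sum>gs\<in>transcripts M n. \<Sum>g | length g = M. weight x (gs @ [g]) * tally (c x) gs)"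
    by (simp add: sum_weight_snoc flip: sum_distrib_right)
  finally show ?case using *
    by (simp add: sum_transcripts_Suc distrib_left sum.distrib)
qed

section \<open>Exponential moments of the gain\<close>

lemma sum_exp_gain_snoc:
  assumes "z < M"
  shows "(\<Sum>x<M. \<Sum>g | length g = M. weight x (gs @ [g]) * exp (gain z gs g)) \<le> (\<Sum>x<M. weight x gs)"
proof (cases "decision gs = None")
  case True
  have "exp (2 / 3) \<le> exp (ln (2::real))"
    using ln2_ge_two_thirds by (simp only: exp_le_cancel_iff)
  then have "exp (2 / 3) * exp (- 1 / 4) \<le> 2 * exp (- 1 / 4 :: real)"
    by simp
  \<comment> \<open>\<open>5 / 12\<close> is \<open>2 / 3 - 1 / 4\<close>, the gain when
    \<open>z\<close> is labelled \<open>True\<close>.\<close>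
  then have "exp (5 / 12) \<le> 2 * exp (- 1 / 4 :: real)"
    by (simp flip: exp_add)
  then have "exp (gain z gs g) \<le> (1 + of_bool (g ! z)) * exp (- 1 / 4)" for g
    using True by (simp add: gain_def)
  then have "(\<Sum>x<M. \<Sum>g | length g = M. weight x (gs @ [g]) * exp (gain z gs g)) \<le>
     (\<Sum>x<M. \<Sum>g | length g = M. weight x (gs @ [g]) * ((1 + of_bool (g ! z)) * exp (- 1 / 4)))"
    by (intro sum_mono mult_left_mono weight_nonneg)
  also have "\<dots> = ((\<Sum>x<M. weight x gs) +
     (\<Sum>x<M. \<Sum>g | length g = M. weight x (gs @ [g]) * of_bool (g ! z))) * exp (- 1 / 4)"
    by (simp add: distrib_left distrib_right sum.distrib sum_weight_snoc
        flip: sum_distrib_right mult.assoc)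
  also have "\<dots> \<le> ((\<Sum>x<M. weight x gs) + (\<Sum>x<M. weight x gs) / 4) * exp (- 1 / 4)"
    using decision_None[OF True assms] by (intro mult_right_mono add_left_mono) auto
  also have "\<dots> = (\<Sum>x<M. weight x gs) * (5 / 4 * exp (- 1 / 4))"
    by (simp add: field_simps)
  also have "\<dots> \<le> (\<Sum>x<M. weight x gs) * 1"
  proof (intro mult_left_mono sum_nonneg weight_nonneg)
    have "1 + 1 / 4 \<le> exp (1 / 4 :: real)" by (rule exp_ge_add_one_self)
    then show "5 / 4 * exp (- 1 / 4) \<le> (1::real)" by (simp add: exp_minus field_simps)
  qed
  finally show ?thesis by simp
next
  case False
  then have "gain z gs g = 0" for g by (simp add: gain_def)
  then show ?thesis by (simp add: sum_weight_snoc)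
qed

text \<open>Supermartingale argument: for \<open>z\<close> fixed independently of the target, no
  round increases the expectation of \<open>exp (tally (gain z) gs)\<close>.\<close>

lemma sum_exp_tally_gain:
  assumes "z < M"
  shows "(\<Sum>gs\<in>transcripts M n. (\<Sum>x<M. weight x gs) * exp (tally (gain z) gs)) \<le> real M"
proof (induction n)
  case 0
  then show ?case by (simp add: transcripts_0)
next
  case (Suc n)
  have "(\<Sum>gs\<in>transcripts M (Suc n). (\<Sum>x<M. weight x gs) * exp (tally (gain z) gs)) =
    (\<Sum>gs\<in>transcripts M n. \<Sum>g | length g = M. \<Sum>x<M. exp (tally (gain z) gs) * (weight x (gs @ [g]) * exp (gain z gs g)))"
    by (simp add: sum_transcripts_Suc exp_add sum_distrib_left sum_distrib_right mult_ac)
  also have "\<dots> = (\<Sum>gs\<in>transcripts M n. exp (tally (gain z) gs) *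
     (\<Sum>x<M. \<Sum>g | length g = M. weight x (gs @ [g]) * exp (gain z gs g)))"
    by (subst sum.swap) (simp add: sum_distrib_left)
  also have "\<dots> \<le> (\<Sum>gs\<in>transcripts M n. exp (tally (gain z) gs) * (\<Sum>x<M. weight x gs))"
    by (intro sum_mono mult_left_mono sum_exp_gain_snoc assms) auto
  finally show ?case using Suc by (simp add: mult.commute)
qed

text \<open>
  By privacy, the joint law of target and outputs is within a factor \<open>exp a\<close> of the product of
  its marginals, where \<open>exp (tally (gain x) gs)\<close> has expectation at most 1. Jensen's inequality
  for \<open>exp\<close> does the rest.
\<close>

lemma sum_tally_gain_le:
  "(\<Sum>x<M. \<Sum>gs\<in>transcripts M T. weight x gs * tally (gain x) gs) \<le> a * real M"
proof -
  have "weight x gs * tally (gain x) gs \<le>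
    (\<Sum>z<M. weight z gs) * exp (tally (gain x) gs) / real M + (a - 1) * weight x gs"
    if "gs \<in> transcripts M T" for x gs
  proof -
    let ?y = "tally (gain x) gs"
    \<comment> \<open>The tangent of \<open>exp\<close> at 0, shifted by \<open>a\<close> so that
      \<open>exp (- a)\<close> absorbs the privacy factor.\<close>
    have "?y \<le> exp (?y - a) + (a - 1)"
      using exp_ge_add_one_self[of "?y - a"] by linarith
    then have "weight x gs * ?y \<le> weight x gs * (exp (?y - a) + (a - 1))"
      by (rule mult_left_mono[OF _ weight_nonneg])
    moreover have "weight x gs * exp (?y - a) \<le> (\<Sum>z<M. weight z gs) * exp ?y / real M"
    proof -
      have "real M * weight x gs * exp (?y - a) \<le> (exp a * (\<Sum>z<M. weight z gs)) * exp (?y - a)"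
        using that by (intro mult_right_mono weight_private) (auto simp: transcripts_def)
      then show ?thesis using M_pos by (simp add: exp_diff field_simps)
    qed
    ultimately show ?thesis by (simp add: algebra_simps)
  qed
  then have "(\<Sum>x<M. \<Sum>gs\<in>transcripts M T. weight x gs * tally (gain x) gs) \<le>
     (\<Sum>x<M. \<Sum>gs\<in>transcripts M T.
       (\<Sum>z<M. weight z gs) * exp (tally (gain x) gs) / real M + (a - 1) * weight x gs)"
    by (intro sum_mono)
  also have "\<dots> = (\<Sum>x<M. (\<Sum>gs\<in>transcripts M T.
       (\<Sum>z<M. weight z gs) * exp (tally (gain x) gs)) / real M + (a - 1))"
    by (simp add: sum.distrib sum_weight flip: sum_distrib_left sum_divide_distrib)
  also have "\<dots> \<le> (\<Sum>x<M. real M / real M + (a - 1))"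
    by (intro sum_mono add_right_mono divide_right_mono sum_exp_tally_gain) auto
  also have "\<dots> = a * real M" using M_pos by simp
  finally show ?thesis .
qed

section \<open>Trading mistakes for information\<close>

lemma mistake_or_gain:
  assumes "length gs < T"
  shows "1 / 8 * (\<Sum>x<M. weight x gs) \<le>
    (\<Sum>x<M. \<Sum>g | length g = M. weight x (gs @ [g]) * (mistake x gs g + 1 / 2 * gain x gs g))"
proof (cases "decision gs")
  case None
  have "1 / 8 * (\<Sum>x<M. weight x gs) =
      (\<Sum>x<M. \<Sum>g | length g = M. weight x (gs @ [g]) * (1 / 8))"
    by (simp add: sum_weight_snoc sum_distrib_left flip: sum_divide_distrib)
  \<comment> \<open>A correct label \<open>True\<close> yields half the gain \<open>5 / 12\<close>,
    a mistake yields \<open>1 - 1 / 8\<close>; both exceed \<open>1 / 8\<close>.\<close>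
  also have "\<dots> \<le> (\<Sum>x<M. \<Sum>g | length g = M. weight x (gs @ [g]) * (mistake x gs g + 1 / 2 * gain x gs g))"
    by (intro sum_mono mult_left_mono weight_nonneg) (simp add: mistake_def gain_def move_def None)
  finally show ?thesis .
next
  case (Some z)
  note z = decision_Some[OF Some]
  \<comment> \<open>Labelling \<open>z\<close> with \<open>True\<close> is a mistake unless
    \<open>z\<close> is the target; that case is subtracted.\<close>
  have "weight x (gs @ [g]) * of_bool (g ! z) - (if x = z then weight x (gs @ [g]) else 0)
      \<le> weight x (gs @ [g]) * (mistake x gs g + 1 / 2 * gain x gs g)" for x g
    using weight_nonneg[of x "gs @ [g]"] by (auto simp: mistake_def gain_def move_def Some)
  then have "(\<Sum>x<M. \<Sum>g | length g = M.
        weight x (gs @ [g]) * of_bool (g ! z) - (if x = z then weight x (gs @ [g]) else 0))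
      \<le> (\<Sum>x<M. \<Sum>g | length g = M. weight x (gs @ [g]) * (mistake x gs g + 1 / 2 * gain x gs g))"
    by (intro sum_mono)
  moreover have "(\<Sum>x<M. \<Sum>g | length g = M. if x = z then weight x (gs @ [g]) else 0) = weight z gs"
  proof -
    have "(\<Sum>x<M. \<Sum>g | length g = M. if x = z then weight x (gs @ [g]) else 0) =
      (\<Sum>x<M. if x = z then weight x gs else 0)"
      by (intro sum.cong refl) (simp add: sum_weight_snoc)
    then show ?thesis using z(1) by simp
  qed
  \<comment> \<open>Given the outputs, any target has probability at most
    \<open>exp a / real M\<close>, hence at most \<open>1 / 8\<close> by
    \<open>M_large\<close>.\<close>
  moreover have "weight z gs \<le> (\<Sum>x<M. weight x gs) / 8"
  proof -
    have "8 * exp a * weight z gs \<le> real M * weight z gs"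
      by (intro mult_right_mono M_large weight_nonneg)
    also have "\<dots> \<le> exp a * (\<Sum>x<M. weight x gs)"
      using assms by (intro weight_private) simp
    finally have "exp a * (8 * weight z gs) \<le> exp a * (\<Sum>x<M. weight x gs)"
      by (simp add: mult_ac)
    then show ?thesis by simp
  qed
  ultimately show ?thesis using z(2) by (simp add: sum_subtractf)
qed

text \<open>On average over targets, mistakes plus half the gain reach \<open>T / 8\<close>, while
  the gain is at most \<open>a\<close>, hence at most \<open>T / 8\<close>; so \<open>T / 16\<close>
  is left for the mistakes.\<close>

lemma exists_hard_target:
  assumes "a \<le> real T / 8"
  shows "\<exists>x<M. real T / 16 \<le> (\<Sum>gs\<in>transcripts M T. weight x gs * tally (mistake x) gs)"
proof (rule ccontr)
  assume "\<not> ?thesis"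
  then have "(\<Sum>x<M. \<Sum>gs\<in>transcripts M T. weight x gs * tally (mistake x) gs) < (\<Sum>x<M. real T / 16)"
    using M_pos by (intro sum_strict_mono) (auto simp: not_le)
  moreover have "1 / 8 * real M * real T \<le>
    (\<Sum>x<M. \<Sum>gs\<in>transcripts M T. weight x gs * tally (\<lambda>gs g. mistake x gs g + 1 / 2 * gain x gs g) gs)"
    by (rule sum_tally_ge) (rule mistake_or_gain)
  then have "1 / 8 * real M * real T \<le>
    (\<Sum>x<M. \<Sum>gs\<in>transcripts M T. weight x gs * tally (mistake x) gs) +
    1 / 2 * (\<Sum>x<M. \<Sum>gs\<in>transcripts M T. weight x gs * tally (gain x) gs)"
    by (simp only: tally_add tally_cmult distrib_left sum.distrib mult.left_commute[of _ "1/2"]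
        sum_distrib_left)
  moreover have "a * real M \<le> real T / 8 * real M"
    using assms by (intro mult_right_mono) auto
  ultimately show False
    using sum_tally_gain_le by (simp add: field_simps)
qed


end

section \<open>The adversary\<close>

context transcript_law
begin

definition strategy :: "nat \<Rightarrow> labelled strategy" where
  "strategy x r H = move x (map (truncate M \<circ> fst) H)"

definition transcript :: "nat \<Rightarrow> nat \<Rightarrow> det_learner \<Rightarrow> bool list list" where
  "transcript x n L = map (truncate M \<circ> fst) (play id L (strategy x 0) n)"

lemma strategy_indep: "strategy x r = strategy x 0"
  by (simp add: fun_eq_iff strategy_def)

lemma play_strategy_Suc: "play id L (strategy x 0) (Suc n) = play id L (strategy x 0) n @
    [(L (map snd (play id L (strategy x 0) n)), move x (transcript x n L))]"
  by (simp add: Let_def transcript_def strategy_def[of x 0 "play id L (strategy x 0) n"])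

text \<open>The learner's inputs can be reconstructed from the truncated outputs, since the
  decisions see nothing else.\<close>

lemma map_snd_play:
  "map snd (play id L (strategy x 0) n) = moves x (decisions (transcript x n L))"
proof (induction n)
  case (Suc n)
  have "transcript x (Suc n) L = transcript x n L @ [truncate M (L (map snd (play id L (strategy x 0) n)))]"
    unfolding transcript_def play_strategy_Suc by simp
  then show ?case
    using Suc by (simp only: play_strategy_Suc moves_decisions_snoc map_append list.map snd_conv)
qed (simp add: transcript_def moves_def)

lemma transcript_0 [simp]: "transcript x 0 L = []"
  by (simp add: transcript_def)

lemma transcript_Suc [simp]: "transcript x (Suc n) L =
    transcript x n L @ [truncate M (L (moves x (decisions (transcript x n L))))]"
  using map_snd_play[of L x n] by (simp add: transcript_def Let_def)

lemma length_transcript [simp]: "length (transcript x n L) = n"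
  by (induction n) auto

lemma transcript_in_transcripts: "transcript x n L \<in> transcripts M n"
  by (induction n) (auto simp: transcripts_def)

text \<open>Passage from the adaptive game to fixed inputs: as long as the outputs follow
  \<open>gs\<close>, the examples presented are those computed from \<open>gs\<close>.\<close>

lemma transcript_eq_iff:
  "transcript x (length gs) L = gs \<longleftrightarrow> outputs M (moves x (decisions gs)) (length gs) L = gs"
proof (induction gs rule: rev_induct)
  case (snoc g gs)
  then show ?case
    by (auto simp: moves_decisions_snoc outputs_append simp del: decisions_snoc)
qed simp

text \<open>\<open>x < M\<close> keeps all presented points below \<open>M\<close>, where truncated
  outputs agree with the hypotheses.\<close>

lemma sum_list_mistakes:
  assumes "x < M"
  shows "(\<Sum>(h, z, y) \<leftarrow> play id L (strategy x r) n. of_bool (h z \<noteq> y)) =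
    tally (mistake x) (transcript x n L)"
  unfolding strategy_indep[of x r]
proof (induction n)
  case (Suc n)
  define H where "H = play id L (strategy x 0) n"
  have "fst (move x gs) < M" for gs using assms by (rule move_less)
  then show ?case using Suc map_snd_play[of L x n]
    unfolding play_strategy_Suc H_def[symmetric] by (simp add: mistake_def split_beta)
qed simp

text \<open>Every example is labelled by \<open>point_fun x\<close>, whatever the learner
  outputs.\<close>

lemma realizable_strategy:
  assumes "prob_space N"
  shows "realizable_adversary POINT T N (strategy x)"
  unfolding realizable_adversary_def adversary_def
proof (intro conjI allI impI assms)
  fix ms :: "labelled list"
  have eq: "map (truncate M \<circ> fst) (zip (map hs [0..<length ms]) ms) =
      map (\<lambda>t. truncate M (hs t)) [0..<length ms]" for hs
    by (rule nth_equalityI) auto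
  show "(\<lambda>(r, hs). strategy x r (zip (map hs [0..<length ms]) ms))
      \<in> N \<Otimes>\<^sub>M PiM {..<length ms} (\<lambda>_. hyp_space) \<rightarrow>\<^sub>M count_space UNIV"
    unfolding strategy_def eq split_beta
    by (rule measurable_compose[OF measurable_map_upt measurable_count_space])
       (rule measurable_compose[OF _ measurable_truncate], measurable)
next
  fix H assume H: "possible_history T N (strategy x) H"
  have "y = point_fun x z" if "(h, z, y) \<in> set H" for h z y
  proof -
    from that obtain t where "t < length H" "H ! t = (h, z, y)" by (auto simp: in_set_conv_nth)
    with H obtain r where "(z, y) = strategy x r (take t H)"
      by (auto simp: possible_history_def)
    then show ?thesis using move_correct by (metis fst_conv snd_conv strategy_def)
  qed
  then show "\<exists>h\<in>POINT. \<forall>(_, z, y)\<in>set H. y = h z"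
    by (auto simp: POINT_def)
qed

end

theorem corollary3p6:
  "\<exists>\<epsilon>\<^sub>0::real. \<epsilon>\<^sub>0 > 0 \<and> (\<exists>C::real. C > 0 \<and>
     (\<forall>(\<epsilon>::real) (T::nat) (P :: det_learner measure).
        0 < \<epsilon> \<longrightarrow> \<epsilon> \<le> \<epsilon>\<^sub>0 \<longrightarrow> T \<ge> 1 \<longrightarrow>
        online_learner P \<longrightarrow> differentially_private \<epsilon> T P \<longrightarrow>
        (\<exists>N A. realizable_adversary POINT T N A \<and>
               expected_mistakes T P N A \<ge> C * real T)))"
proof (rule exI[of _ "1 / 8"], rule conjI, simp, rule exI[of _ "1 / 16"], rule conjI, simp,
    intro allI impI)
  fix \<epsilon> :: real and T :: nat and P :: "det_learner measure"
  assume \<epsilon>: "0 < \<epsilon>" "\<epsilon> \<le> 1 / 8" and P: "online_learner P" "differentially_private \<epsilon> T P"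
  interpret prob_space P using P by (simp add: online_learner_def)
  define M where "M = nat \<lceil>8 * exp (real T * \<epsilon>)\<rceil>"
  interpret transcript_law "output_prob P M" M T "real T * \<epsilon>"
  proof
    fix xs ys :: "labelled list" and gs g and m :: labelled
    show "output_prob P M xs gs \<ge> 0" by (simp add: output_prob_def)
    show "output_prob P M xs [] = 1"
      using prob_space space_online_learner[OF P(1)] by (simp add: output_prob_def)
    show "(\<Sum>g | length g = M. output_prob P M xs (gs @ [g])) = output_prob P M xs gs"
      by (rule sum_output_prob[OF P(1)])
    show "output_prob P M (xs @ [m]) (gs @ [g]) = output_prob P M xs (gs @ [g])"
      if "length xs = length gs"
      using that by (simp add: output_prob_def outputs_append)
    show "output_prob P M xs gs \<le> exp (real T * \<epsilon>) * output_prob P M ys gs"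
      if "length xs = length gs" "length ys = length gs" "length gs \<le> T"
      using output_prob_private[OF P] \<epsilon> that by simp
    show "8 * exp (real T * \<epsilon>) \<le> real M"
      unfolding M_def by (rule real_nat_ceiling_ge)
  qed
  \<comment> \<open>\<open>\<epsilon> \<le> 1 / 8\<close> is what makes the privacy budget
    \<open>real T * \<epsilon>\<close> at most \<open>real T / 8\<close>.\<close>
  obtain x where x: "x < M"
    and hard: "real T / 16 \<le> (\<Sum>gs\<in>transcripts M T. weight x gs * tally (mistake x) gs)"
    using exists_hard_target mult_left_mono[OF \<epsilon>(2), of "real T"] by auto
  define N where "N = return borel (0 :: real)"
  interpret N: prob_space N unfolding N_def by (rule prob_space_return) simp
  have event: "{L. transcript x T L = gs} \<in> events" "prob {L. transcript x T L = gs} = weight x gs"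
    if "gs \<in> transcripts M T" for gs
  proof -
    have "{L. transcript x T L = gs} = {L. outputs M (moves x (decisions gs)) (length gs) L = gs}"
      using transcript_eq_iff[of x gs] that by (auto simp: transcripts_def)
    then show "{L. transcript x T L = gs} \<in> events" "prob {L. transcript x T L = gs} = weight x gs"
      using outputs_event[OF P(1)] by (simp_all add: weight_def output_prob_def)
  qed
  let ?f = "\<lambda>L. tally (mistake x) (transcript x T L)"
  \<comment> \<open>As a finite combination of indicators of transcript events, the number of
    mistakes is measurable and its integral is a finite sum.\<close>
  have f: "?f L = (\<Sum>gs\<in>transcripts M T. indicator {L. transcript x T L = gs} L * tally (mistake x) gs)" for L
    by (subst sum.remove[OF finite_transcripts transcript_in_transcripts[of x T L]])
       (auto simp: indicator_def intro!: sum.neutral)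
  have integrable: "integrable P (indicat_real {L. transcript x T L = gs})"
    if "gs \<in> transcripts M T" for gs
    using event(1)[OF that] by (intro integrable_real_indicator) (auto simp: less_top[symmetric])
  have [measurable]: "?f \<in> borel_measurable P"
    unfolding f using event by measurable
  have "expected_mistakes T P N (strategy x) = (\<integral>p. ?f (fst p) \<partial>(P \<Otimes>\<^sub>M N))"
    unfolding expected_mistakes_def sum_list_mistakes[OF x]
    by (simp only: case_prod_unfold)
  also have "\<dots> = (\<integral>L. ?f L \<partial>distr (P \<Otimes>\<^sub>M N) P fst)"
    by (rule integral_distr[symmetric]) measurable
  also have "\<dots> = (\<integral>L. ?f L \<partial>P)"
    by (simp only: N.distr_pair_fst)
  also have "\<dots> = (\<Sum>gs\<in>transcripts M T. weight x gs * tally (mistake x) gs)"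
    unfolding f using event integrable by (subst Bochner_Integration.integral_sum) (auto intro!: sum.cong)
  finally have "expected_mistakes T P N (strategy x) \<ge> 1 / 16 * real T"
    using hard by simp
  then show "\<exists>N A. realizable_adversary POINT T N A \<and> 1 / 16 * real T \<le> expected_mistakes T P N A"
    using realizable_strategy[OF N.prob_space_axioms] by blast
qed

end
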